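(* Let $V$ be an $N=2$ vertex superalgebra with two odd formal variables and let $\mathcal{D}^\pm$ be the odd endomorphisms of $V$ defined by $\mathcal{D}^\pm(v)=v^\pm_{-\frac32}\mathbf{1}$ for $v\in V$. Then for all $v\in V$ $$Y(\mathcal{D}^\pm v,(x,\varphi^+,\varphi^-))=\Big(\frac{\partial}{\partial\varphi^\pm}+\varphi^\mp\frac{\partial}{\partial x}\Big)Y(v,(x,\varphi^+,\varphi^-)).$$
   Context: Grassmann algebra: $\bigwedge_L$ ($L\in\mathbb{N}$) is the exterior algebra over $\mathbb{C}$ on $L$ generators, $\bigwedge_L\subset\bigwedge_{L+1}$, $\bigwedge_\infty=\bigcup_L\bigwedge_L$; $\bigwedge_*$ is one of these, with even and odd parts $\bigwedge_*^0,\bigwedge_*^1$. For $V=V^0\oplus V^1$ write $\eta(v)=j$ if $v\in V^j$. Formal variables: $x,x_0,x_1,x_2$ are even (commute with everything); $\varphi^\pm,\varphi_1^\pm,\varphi_2^\pm$ are odd (commute with even variables and even elements; anticommute with each other, with $\bigwedge_*^1$ and with odd endomorphisms; squares vanish). $\delta(x)=\sum_{n\in\mathbb{Z}}x^n$; expressions containing products of odd variables are Taylor expanded about the even variables, and powers of a sum of two even variables are expanded in nonnegative powers of the second one, e.g. $\delta\big(\frac{x_1-x_2-\nu}{x_0}\big)=\sum_n(x_1-x_2-\nu)^nx_0^{-n}$. An $N=2$ vertex superalgebra over $\bigwedge_*$ with two odd formal variables, $(V,Y(\cdot,(x,\varphi^+,\varphi^-)),\mathbf{1})$, consists of a $\mathbb{Z}_2$-graded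 $\bigwedge_*$-module $V=V^0\oplus V^1$, a linear map $v\mapsto Y(v,(x,\varphi^+,\varphi^-))=\sum_{n\in\mathbb{Z}}(v_n+\varphi^+v^+_{n-\frac12}+\varphi^-v^-_{n-\frac12}+\varphi^+\varphi^-v^{+-}_{n-1})x^{-n-1}\in(\mathrm{End}\,V)[[x,x^{-1}]][\varphi^+,\varphi^-]$ with $v_n,v^{+-}_n\in(\mathrm{End}\,V)^{\eta(v)}$ and $v^\pm_{n-\frac12}\in(\mathrm{End}\,V)^{\eta(v)+1\bmod2}$ for homogeneous $v$, and $\mathbf{1}\in V$, such that for $u,v\in V$: (truncation) $u_nv=u^{+-}_nv=u^\pm_{n-\frac12}v=0$ for $n$ sufficiently large; (vacuum) $Y(\mathbf{1},(x,\varphi^+,\varphi^-))=\mathrm{id}_V$; (creation) $Y(v,(x,\varphi^+,\varphi^-))\mathbf{1}\in V[[x]][\varphi^+,\varphi^-]$ and its value at $(x,\varphi^+,\varphi^-)=0$ is $v$; (Jacobi identity) for $u,v$ of homogeneous sign $$x_0^{-1}\delta\Big(\tfrac{x_1-x_2-\varphi_1^+\varphi_2^--\varphi_1^-\varphi_2^+}{x_0}\Big)Y(u,(x_1,\varphi_1^+,\varphi_1^-))Y(v,(x_2,\varphi_2^+,\varphi_2^-))-(-1)^{\eta(u)\eta(v)}x_0^{-1}\delta\Big(\tfrac{x_2-x_1+\varphi_1^+\varphi_2^-+\varphi_1^-\varphi_2^+}{-x_0}\Big)Y(v,(x_2,\varphi_2^+,\varphi_2^-))Y(u,(x_1,\varphi_1^+,\varphi_1^-))$$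 $$=x_2^{-1}\delta\Big(\tfrac{x_1-x_0-\varphi_1^+\varphi_2^--\varphi_1^-\varphi_2^+}{x_2}\Big)Y(Y(u,(x_0,\varphi_1^+-\varphi_2^+,\varphi_1^--\varphi_2^-))v,(x_2,\varphi_2^+,\varphi_2^-)).$$ *)

theory Defs
  imports
    Complex_Main
    "HOL-Library.Extended_Nat"
    "HOL-Library.Groups_Big_Fun"
begin

section \<open>Exterior algebras over the complex numbers\<close>

text \<open>
  The exterior algebra on generators \<open>\<zeta> i\<close>, \<open>i :: 'i\<close>, in the basis of the ordered monomials
  \<open>\<zeta> A = \<zeta> i1 \<cdots> \<zeta> ik\<close> for finite \<open>A = {i1 < \<dots> < ik}\<close>.  It is used in two roles:
  with \<open>'i = nat\<close> for the Grassmann algebra of coefficients, and with \<open>'i\<close> the type of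
  odd formal variables for the polynomials in those variables.
\<close>

typedef 'i grassmann =
  "{f :: 'i set \<Rightarrow> complex. finite {A. f A \<noteq> 0} \<and> (\<forall>A. infinite A \<longrightarrow> f A = 0)}"
  morphisms gcoeff Abs_grassmann
  by (rule exI[of _ "\<lambda>_. 0"]) simp

setup_lifting type_definition_grassmann

text \<open>For disjoint \<open>A\<close> and \<open>B\<close> one has \<open>\<zeta> A * \<zeta> B = msign A B * \<zeta> (A \<union> B)\<close>.\<close>

definition msign :: "'i::linorder set \<Rightarrow> 'i set \<Rightarrow> complex" where
  "msign A B = (-1) ^ card {(a, b). a \<in> A \<and> b \<in> B \<and> b < a}"

lemma msign_empty [simp]: "msign {} B = 1" "msign A {} = 1"
  by (simp_all add: msign_def)

lemma msign_Un_left: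
  assumes "finite A" "finite B" "finite C" "A \<inter> B = {}"
  shows "msign (A \<union> B) C = msign A C * msign B C"
proof -
  have *: "finite {(a, b). a \<in> X \<and> b \<in> C \<and> b < a}" if "finite X" for X
    by (rule finite_subset[of _ "X \<times> C"]) (use that assms in auto)
  have "{(a, b). a \<in> A \<union> B \<and> b \<in> C \<and> b < a} =
      {(a, b). a \<in> A \<and> b \<in> C \<and> b < a} \<union> {(a, b). a \<in> B \<and> b \<in> C \<and> b < a}"
    by auto
  moreover have "{(a, b). a \<in> A \<and> b \<in> C \<and> b < a} \<inter> {(a, b). a \<in> B \<and> b \<in> C \<and> b < a} = {}"
    using assms by auto
  ultimately show ?thesis
    using * assms by (simp add: msign_def card_Un_disjoint power_add)
qed

lemma msign_Un_right:
  assumes "finite A" "finite B" "finite C" "B \<inter> C = {}"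
  shows "msign A (B \<union> C) = msign A B * msign A C"
proof -
  have *: "finite {(a, b). a \<in> A \<and> b \<in> X \<and> b < a}" if "finite X" for X
    by (rule finite_subset[of _ "A \<times> X"]) (use that assms in auto)
  have "{(a, b). a \<in> A \<and> b \<in> B \<union> C \<and> b < a} =
      {(a, b). a \<in> A \<and> b \<in> B \<and> b < a} \<union> {(a, b). a \<in> A \<and> b \<in> C \<and> b < a}"
    by auto
  moreover have "{(a, b). a \<in> A \<and> b \<in> B \<and> b < a} \<inter> {(a, b). a \<in> A \<and> b \<in> C \<and> b < a} = {}"
    using assms by auto
  ultimately show ?thesis
    using * assms by (simp add: msign_def card_Un_disjoint power_add)
qed

instantiation grassmann :: (linorder) ring_1
begin

lift_definition zero_grassmann :: "'a grassmann" is "\<lambda>_. 0" by simp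

lift_definition one_grassmann :: "'a grassmann" is "\<lambda>A. if A = {} then 1 else 0" by auto

lift_definition plus_grassmann :: "'a grassmann \<Rightarrow> 'a grassmann \<Rightarrow> 'a grassmann"
  is "\<lambda>f g A. f A + g A"
proof -
  fix f g :: "'a set \<Rightarrow> complex"
  assume "finite {A. f A \<noteq> 0} \<and> (\<forall>A. infinite A \<longrightarrow> f A = 0)"
    "finite {A. g A \<noteq> 0} \<and> (\<forall>A. infinite A \<longrightarrow> g A = 0)"
  moreover have "{A. f A + g A \<noteq> 0} \<subseteq> {A. f A \<noteq> 0} \<union> {A. g A \<noteq> 0}" by auto
  ultimately show "finite {A. f A + g A \<noteq> 0} \<and> (\<forall>A. infinite A \<longrightarrow> f A + g A = 0)"
    by (auto intro: finite_subset[OF _ finite_UnI])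
qed

lift_definition uminus_grassmann :: "'a grassmann \<Rightarrow> 'a grassmann" is "\<lambda>f A. - f A"
  by simp

lift_definition minus_grassmann :: "'a grassmann \<Rightarrow> 'a grassmann \<Rightarrow> 'a grassmann"
  is "\<lambda>f g A. f A - g A"
proof -
  fix f g :: "'a set \<Rightarrow> complex"
  assume "finite {A. f A \<noteq> 0} \<and> (\<forall>A. infinite A \<longrightarrow> f A = 0)"
    "finite {A. g A \<noteq> 0} \<and> (\<forall>A. infinite A \<longrightarrow> g A = 0)"
  moreover have "{A. f A - g A \<noteq> 0} \<subseteq> {A. f A \<noteq> 0} \<union> {A. g A \<noteq> 0}" by auto
  ultimately show "finite {A. f A - g A \<noteq> 0} \<and> (\<forall>A. infinite A \<longrightarrow> f A - g A = 0)"
    by (auto intro: finite_subset[OF _ finite_UnI])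
qed

lift_definition times_grassmann :: "'a grassmann \<Rightarrow> 'a grassmann \<Rightarrow> 'a grassmann"
  is "\<lambda>f g C. \<Sum>A\<in>Pow C. msign A (C - A) * f A * g (C - A)"
proof -
  fix f g :: "'a set \<Rightarrow> complex"
  assume f: "finite {A. f A \<noteq> 0} \<and> (\<forall>A. infinite A \<longrightarrow> f A = 0)"
    and g: "finite {A. g A \<noteq> 0} \<and> (\<forall>A. infinite A \<longrightarrow> g A = 0)"
  let ?h = "\<lambda>C. \<Sum>A\<in>Pow C. msign A (C - A) * f A * g (C - A)"
  have "{C. ?h C \<noteq> 0} \<subseteq> (\<lambda>(A, B). A \<union> B) ` ({A. f A \<noteq> 0} \<times> {A. g A \<noteq> 0})"
  proof
    fix C assume "C \<in> {C. ?h C \<noteq> 0}"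
    then obtain A where A: "A \<in> Pow C" "msign A (C - A) * f A * g (C - A) \<noteq> 0"
      by (metis (mono_tags, lifting) mem_Collect_eq sum.neutral)
    then show "C \<in> (\<lambda>(A, B). A \<union> B) ` ({A. f A \<noteq> 0} \<times> {A. g A \<noteq> 0})"
      by (intro image_eqI[of _ _ "(A, C - A)"]) auto
  qed
  then have "finite {C. ?h C \<noteq> 0}"
    by (rule finite_subset) (use f g in auto)
  then show "finite {C. ?h C \<noteq> 0} \<and> (\<forall>C. infinite C \<longrightarrow> ?h C = 0)"
    by (simp add: finite_Pow_iff)
qed

instance
proof
  fix a b c :: "'a grassmann"
  show "a + b + c = a + (b + c)" by transfer (simp add: add.assoc)
  show "a + b = b + a" by transfer (simp add: add.commute)
  show "0 + a = a" by transfer simp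
  show "- a + a = 0" by transfer simp
  show "a - b = a + - b" by transfer simp
  show "(a + b) * c = a * c + b * c"
    by transfer (simp add: distrib_left distrib_right sum.distrib)
  show "a * (b + c) = a * b + a * c"
    by transfer (simp add: distrib_left distrib_right sum.distrib)
  show "(0::'a grassmann) \<noteq> 1" by transfer (auto simp: fun_eq_iff)
  show "1 * a = a"
  proof (transfer, rule ext)
    fix f :: "'a set \<Rightarrow> complex" and C
    assume f: "finite {A. f A \<noteq> 0} \<and> (\<forall>A. infinite A \<longrightarrow> f A = 0)"
    show "(\<Sum>A\<in>Pow C. msign A (C - A) * (if A = {} then 1 else 0) * f (C - A)) = f C"
    proof (cases "finite C")
      case True
      have "(\<Sum>A\<in>Pow C. msign A (C - A) * (if A = {} then 1 else 0) * f (C - A)) =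
          (\<Sum>A\<in>Pow C. if A = {} then f C else 0)"
        by (rule sum.cong) auto
      then show ?thesis using True by (simp add: sum.delta)
    qed (use f in \<open>simp add: finite_Pow_iff\<close>)
  qed
  show "a * 1 = a"
  proof (transfer, rule ext)
    fix f :: "'a set \<Rightarrow> complex" and C
    assume f: "finite {A. f A \<noteq> 0} \<and> (\<forall>A. infinite A \<longrightarrow> f A = 0)"
    show "(\<Sum>A\<in>Pow C. msign A (C - A) * f A * (if C - A = {} then 1 else 0)) = f C"
    proof (cases "finite C")
      case True
      have "(\<Sum>A\<in>Pow C. msign A (C - A) * f A * (if C - A = {} then 1 else 0)) =
          (\<Sum>A\<in>Pow C. if A = C then f C else 0)"
        by (rule sum.cong) (auto simp: Diff_eq_empty_iff)
      then show ?thesis using True by (simp add: sum.delta)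
    qed (use f in \<open>simp add: finite_Pow_iff\<close>)
  qed
  show "a * b * c = a * (b * c)"
  proof (transfer, rule ext)
    fix f g h :: "'a set \<Rightarrow> complex" and C
    let ?L = "\<lambda>T S. msign T (C - T) * (msign S (T - S) * f S * g (T - S)) * h (C - T)"
    let ?R = "\<lambda>S R. msign S (C - S) * f S * (msign R (C - S - R) * g R * h (C - S - R))"
    show "(\<Sum>T\<in>Pow C. msign T (C - T) * (\<Sum>S\<in>Pow T. msign S (T - S) * f S * g (T - S)) * h (C - T))
      = (\<Sum>S\<in>Pow C. msign S (C - S) * f S *
          (\<Sum>R\<in>Pow (C - S). msign R (C - S - R) * g R * h (C - S - R)))" (is "?lhs = ?rhs")
    proof (cases "finite C")
      case True
      then have fin: "finite S" if "S \<subseteq> C" for S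
        using that finite_subset by blast
      have "?lhs = (\<Sum>(T, S)\<in>Sigma (Pow C) Pow. ?L T S)"
        unfolding sum_distrib_left sum_distrib_right
        by (rule sum.Sigma) (use True fin in auto)
      also have "\<dots> = (\<Sum>(S, R)\<in>Sigma (Pow C) (\<lambda>S. Pow (C - S)). ?R S R)"
      proof (rule sum.reindex_bij_witness[where i = "\<lambda>(S, R). (S \<union> R, S)"
            and j = "\<lambda>(T, S). (S, T - S)"], goal_cases)
        case (5 p)
        then obtain T S where p: "p = (T, S)" "S \<subseteq> T" "T \<subseteq> C" by auto
        define R U where "R = T - S" and "U = C - T"
        have *: "T = S \<union> R" "C - S = R \<union> U" "C - S - R = U" "S \<inter> R = {}" "R \<inter> U = {}"
          "S \<inter> U = {}" "finite S" "finite R" "finite U"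
          using p fin unfolding R_def U_def by auto
        have "msign T U * msign S R = msign S (C - S) * msign R U"
          unfolding *(1,2) using * by (simp add: msign_Un_left msign_Un_right)
        moreover have "T - S = R" "C - T = U"
          by (simp_all add: R_def U_def)
        ultimately show ?case
          using *(3) unfolding p by simp
      qed auto
      also have "\<dots> = ?rhs"
        unfolding sum_distrib_left
        by (rule sum.Sigma[symmetric]) (use True fin in auto)
      finally show ?thesis .
    qed (simp add: finite_Pow_iff)
  qed
qed

end

lift_definition gconst :: "complex \<Rightarrow> 'i::linorder grassmann" is "\<lambda>c A. if A = {} then c else 0"
  by auto

lift_definition gen :: "'i::linorder \<Rightarrow> 'i grassmann" is "\<lambda>i A. if A = {i} then 1 else 0"
  by auto

lemma gen_mult:
  "gcoeff (gen i * gen j) = (\<lambda>A. if i \<noteq> j \<and> A = {i, j} then msign {i} {j} else 0)"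
proof (transfer, rule ext)
  fix i j :: 'a and C
  have eq: "{i} \<subseteq> C \<and> C - {i} = {j} \<longleftrightarrow> i \<noteq> j \<and> C = {i, j}" by blast
  show "(\<Sum>A\<in>Pow C. msign A (C - A) * (if A = {i} then 1 else 0) * (if C - A = {j} then 1 else 0)) =
      (if i \<noteq> j \<and> C = {i, j} then msign {i} {j} else 0)"
  proof (cases "finite C")
    case True
    have "(\<Sum>A\<in>Pow C. msign A (C - A) * (if A = {i} then 1 else 0) * (if C - A = {j} then 1 else 0)) =
        (\<Sum>A\<in>Pow C. if A = {i} then (if C - {i} = {j} then msign {i} {j} else 0) else 0)"
      by (rule sum.cong) auto
    also have "\<dots> = (if {i} \<subseteq> C \<and> C - {i} = {j} then msign {i} {j} else 0)"
      using True by (subst sum.delta) auto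
    finally show ?thesis unfolding eq .
  qed (auto simp: finite_Pow_iff)
qed

lemma gen_square: "gen i * gen i = 0"
  by (simp add: gcoeff_inject[symmetric] gen_mult zero_grassmann.rep_eq)

lemma gen_anticommute: "gen i * gen j = - (gen j * gen i)"
proof -
  have "msign {i} {j} = - msign {j} {i}" if "i \<noteq> j"
  proof -
    have "{(a, b). a \<in> {x} \<and> b \<in> {y} \<and> b < a} = (if y < x then {(x, y)} else {})" for x y :: 'a
      by auto
    then show ?thesis using that by (auto simp: msign_def)
  qed
  then show ?thesis
    by (auto simp: gcoeff_inject[symmetric] gen_mult uminus_grassmann.rep_eq fun_eq_iff insert_commute)
qed

definition Lambda :: "enat \<Rightarrow> nat grassmann set" where
  "Lambda L = {a. \<forall>A. gcoeff a A \<noteq> 0 \<longrightarrow> (\<forall>i\<in>A. enat i < L)}"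

text \<open>Here and below, parities are the natural numbers \<open>0\<close> and \<open>1\<close>.\<close>

definition Lambda_part :: "enat \<Rightarrow> nat \<Rightarrow> nat grassmann set" where
  "Lambda_part L j = {a \<in> Lambda L. \<forall>A. gcoeff a A \<noteq> 0 \<longrightarrow> card A mod 2 = j}"


section \<open>Graded modules and their endomorphisms\<close>

text \<open>
  The scalar multiplication is a function on all of \<open>nat grassmann\<close>, but only its values on
  \<open>Lambda L\<close> matter. Complex scalars act through \<open>gconst\<close>.
\<close>

locale graded_module =
  fixes L :: enat
    and smul :: "nat grassmann \<Rightarrow> 'v \<Rightarrow> 'v::ab_group_add"
    and Vp :: "nat \<Rightarrow> 'v set"
  assumes smul_add_right: "a \<in> Lambda L \<Longrightarrow> smul a (v + w) = smul a v + smul a w"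
    and smul_add_left: "a \<in> Lambda L \<Longrightarrow> b \<in> Lambda L \<Longrightarrow> smul (a + b) v = smul a v + smul b v"
    and smul_smul: "a \<in> Lambda L \<Longrightarrow> b \<in> Lambda L \<Longrightarrow> smul (a * b) v = smul a (smul b v)"
    and smul_one: "smul 1 v = v"
    and Vp_zero: "j < 2 \<Longrightarrow> 0 \<in> Vp j"
    and Vp_add: "j < 2 \<Longrightarrow> v \<in> Vp j \<Longrightarrow> w \<in> Vp j \<Longrightarrow> v + w \<in> Vp j"
    and Vp_smul: "i < 2 \<Longrightarrow> j < 2 \<Longrightarrow> a \<in> Lambda_part L i \<Longrightarrow> v \<in> Vp j \<Longrightarrow>
      smul a v \<in> Vp ((i + j) mod 2)"
    and Vp_Int: "Vp 0 \<inter> Vp 1 = {0}"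
    and Vp_sum: "\<exists>v0\<in>Vp 0. \<exists>v1\<in>Vp 1. v = v0 + v1"

text \<open>
  The endomorphisms of parity \<open>j\<close>. An odd endomorphism anticommutes with the
  odd elements of the Grassmann algebra.
\<close>

definition End_part ::
  "enat \<Rightarrow> (nat grassmann \<Rightarrow> 'v \<Rightarrow> 'v) \<Rightarrow> (nat \<Rightarrow> 'v set) \<Rightarrow> nat \<Rightarrow> ('v::ab_group_add \<Rightarrow> 'v) set"
  where
  "End_part L smul Vp j = {P.
     (\<forall>v w. P (v + w) = P v + P w) \<and>
     (\<forall>i<2. \<forall>a\<in>Lambda_part L i. \<forall>v. P (smul a v) = smul ((-1) ^ (i * j) * a) (P v)) \<and>
     (\<forall>i<2. P ` Vp i \<subseteq> Vp ((i + j) mod 2))}"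


section \<open>Formal variables\<close>

datatype pm = Plus | Minus

datatype ovar = Phi1 pm | Phi2 pm

datatype evar = X0 | X1 | X2

fun opp :: "pm \<Rightarrow> pm" where
  "opp Plus = Minus"
| "opp Minus = Plus"

instantiation pm :: linorder
begin
definition less_eq_pm :: "pm \<Rightarrow> pm \<Rightarrow> bool" where "s \<le> t \<longleftrightarrow> s = Plus \<or> t = Minus"
definition less_pm :: "pm \<Rightarrow> pm \<Rightarrow> bool" where "s < t \<longleftrightarrow> s = Plus \<and> t = Minus"
instance
proof
  fix x y z :: pm
  show "(x < y) = (x \<le> y \<and> \<not> y \<le> x)" "x \<le> x" "x \<le> y \<Longrightarrow> y \<le> z \<Longrightarrow> x \<le> z"
    "x \<le> y \<Longrightarrow> y \<le> x \<Longrightarrow> x = y" "x \<le> y \<or> y \<le> x"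
    by (cases x; cases y; cases z; simp add: less_eq_pm_def less_pm_def)+
qed
end

fun ovar_pos :: "ovar \<Rightarrow> nat" where
  "ovar_pos (Phi1 Plus) = 0"
| "ovar_pos (Phi1 Minus) = 1"
| "ovar_pos (Phi2 Plus) = 2"
| "ovar_pos (Phi2 Minus) = 3"

lemma ovar_pos_inj: "ovar_pos p = ovar_pos q \<Longrightarrow> p = q"
  by (cases p rule: ovar_pos.cases; cases q rule: ovar_pos.cases) auto

instantiation ovar :: linorder
begin
definition less_eq_ovar :: "ovar \<Rightarrow> ovar \<Rightarrow> bool" where "p \<le> q \<longleftrightarrow> ovar_pos p \<le> ovar_pos q"
definition less_ovar :: "ovar \<Rightarrow> ovar \<Rightarrow> bool" where "p < q \<longleftrightarrow> ovar_pos p < ovar_pos q"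
instance
  by standard (auto simp: less_eq_ovar_def less_ovar_def ovar_pos_inj)
end

instance pm :: finite
proof
  have "(UNIV :: pm set) = {Plus, Minus}" using pm.exhaust by auto
  then show "finite (UNIV :: pm set)" by (metis finite.emptyI finite_insert)
qed

instance ovar :: finite
proof
  have "inj ovar_pos" by (auto simp: inj_def ovar_pos_inj)
  moreover have "range ovar_pos \<subseteq> {..3}"
  proof
    fix n assume "n \<in> range ovar_pos"
    then obtain p where "n = ovar_pos p" by auto
    then show "n \<in> {..3}" by (cases p rule: ovar_pos.cases) auto
  qed
  ultimately show "finite (UNIV :: ovar set)" by (metis finite_atMost finite_imageD finite_subset)
qed


section \<open>Series in one even variable \<open>x\<close> and the odd variables \<open>\<phi>\<^sup>+\<close>, \<open>\<phi>\<^sup>-\<close>\<close>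

text \<open>
  \<open>F k S\<close> is the coefficient of \<open>\<phi> S x^k\<close>, where \<open>\<phi> {}\<close>, \<open>\<phi> {Plus}\<close>, \<open>\<phi> {Minus}\<close> and
  \<open>\<phi> {Plus, Minus}\<close> are \<open>1\<close>, \<open>\<phi>\<^sup>+\<close>, \<open>\<phi>\<^sup>-\<close> and \<open>\<phi>\<^sup>+\<phi>\<^sup>-\<close>, standing to the left of the coefficient.
  Hence, for a vertex operator \<open>Y v\<close>, the modes of \<open>v\<close> are
  \<open>v\<^bsub>n\<^esub> = mode Y v n {}\<close>, \<open>v\<^sup>\<plusminus>\<^bsub>n-1/2\<^esub> = mode Y v n {\<plusminus>}\<close> and \<open>v\<^sup>+\<^sup>-\<^bsub>n-1\<^esub> = mode Y v n {Plus, Minus}\<close>.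
\<close>

type_synonym 'v End_series = "int \<Rightarrow> pm set \<Rightarrow> 'v \<Rightarrow> 'v"

definition mode :: "('v \<Rightarrow> 'v End_series) \<Rightarrow> 'v \<Rightarrow> int \<Rightarrow> pm set \<Rightarrow> 'v \<Rightarrow> 'v" where
  "mode Y v n S = Y v (- n - 1) S"

definition scale :: "(nat grassmann \<Rightarrow> 'v \<Rightarrow> 'v) \<Rightarrow> complex \<Rightarrow> 'v \<Rightarrow> 'v" where
  "scale smul c = smul (gconst c)"

definition diff_x :: "(nat grassmann \<Rightarrow> 'v \<Rightarrow> 'v) \<Rightarrow> 'v End_series \<Rightarrow> 'v End_series" where
  "diff_x smul F = (\<lambda>k S w. scale smul (of_int (k + 1)) (F (k + 1) S w))"

text \<open>Both operators below act from the left, so \<open>\<partial>/\<partial>\<phi>\<^sup>- (\<phi>\<^sup>+\<phi>\<^sup>-) = - \<phi>\<^sup>+\<close>.\<close>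

definition diff_phi ::
  "(nat grassmann \<Rightarrow> 'v \<Rightarrow> 'v) \<Rightarrow> pm \<Rightarrow> 'v End_series \<Rightarrow> 'v::zero End_series" where
  "diff_phi smul s F = (\<lambda>k S w.
     if s \<in> S then 0 else scale smul (msign {s} S) (F k (insert s S) w))"

definition mult_phi ::
  "(nat grassmann \<Rightarrow> 'v \<Rightarrow> 'v) \<Rightarrow> pm \<Rightarrow> 'v End_series \<Rightarrow> 'v::zero End_series" where
  "mult_phi smul s F = (\<lambda>k S w.
     if s \<in> S then scale smul (msign {s} (S - {s})) (F k (S - {s}) w) else 0)"


section \<open>Series in \<open>x\<^sub>0, x\<^sub>1, x\<^sub>2\<close> and the odd variables \<open>\<phi>\<^sub>1\<^sup>\<plusminus>, \<phi>\<^sub>2\<^sup>\<plusminus>\<close>\<close>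

text \<open>
  A \<open>scalar_series\<close> assigns to an exponent \<open>e\<close> the coefficient of
  \<open>x\<^sub>0^(e X0) x\<^sub>1^(e X1) x\<^sub>2^(e X2)\<close>, a polynomial in the odd variables. In a \<open>'v vec_series\<close> these
  coefficients lie in \<open>\<complex>[\<phi>\<^sub>1\<^sup>\<plusminus>, \<phi>\<^sub>2\<^sup>\<plusminus>] \<otimes> V\<close>, and are given by the components in
  \<open>V\<close> of the ordered monomials in the odd variables.
\<close>

type_synonym scalar_series = "(evar \<Rightarrow> int) \<Rightarrow> ovar grassmann"
type_synonym 'v vec_series = "(evar \<Rightarrow> int) \<Rightarrow> ovar set \<Rightarrow> 'v"

definition phi1 :: "pm \<Rightarrow> ovar grassmann" where "phi1 s = gen (Phi1 s)"
definition phi2 :: "pm \<Rightarrow> ovar grassmann" where "phi2 s = gen (Phi2 s)"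

definition nu :: "ovar grassmann" where
  "nu = phi1 Plus * phi2 Minus + phi1 Minus * phi2 Plus"

lemma nu_cube: "nu ^ 3 = 0"
proof -
  define a b c d :: "ovar grassmann" where
    "a = gen (Phi1 Plus)" and "b = gen (Phi2 Minus)" and
    "c = gen (Phi1 Minus)" and "d = gen (Phi2 Plus)"
  have sq: "a * (a * x) = 0" "b * (b * x) = 0" "c * (c * x) = 0" "d * (d * x) = 0"
    "a * a = 0" "b * b = 0" "c * c = 0" "d * d = 0" for x
    by (simp_all add: a_def b_def c_def d_def gen_square flip: mult.assoc)
  have ac: "b * a = - (a * b)" "c * a = - (a * c)" "d * a = - (a * d)"
    "c * b = - (b * c)" "d * b = - (b * d)" "d * c = - (c * d)"
    using gen_anticommute unfolding a_def b_def c_def d_def by blast+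
  have ac': "b * (a * x) = - (a * (b * x))" "c * (a * x) = - (a * (c * x))"
    "d * (a * x) = - (a * (d * x))" "c * (b * x) = - (b * (c * x))"
    "d * (b * x) = - (b * (d * x))" "d * (c * x) = - (c * (d * x))" for x
    by (simp_all add: ac flip: mult.assoc)
  have nu: "nu = a * b + c * d"
    by (simp add: nu_def phi1_def phi2_def a_def b_def c_def d_def)
  show ?thesis
    unfolding power3_eq_cube nu
    by (simp add: distrib_left distrib_right mult.assoc ac ac' sq)
qed

text \<open>
  The coefficient of \<open>y^p z^q\<close> in \<open>(y - z + \<mu>)^n\<close>, where \<open>\<mu>\<close> is even with \<open>\<mu>^3 = 0\<close>: Taylor
  expansion in \<open>\<mu>\<close> gives \<open>\<Sum>j\<le>2. (n gchoose j) \<mu>^j (y - z)^(n - j)\<close>, and \<open>(y - z)^(n - j)\<close> is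
  expanded in nonnegative powers of \<open>z\<close>.
\<close>

definition pow_expand :: "ovar grassmann \<Rightarrow> int \<Rightarrow> int \<Rightarrow> int \<Rightarrow> ovar grassmann" where
  "pow_expand \<mu> n p q = (\<Sum>j\<le>2. if 0 \<le> q \<and> p + q = n - int j
     then gconst ((of_int n gchoose j) * (of_int (n - int j) gchoose nat q) * (-1) ^ nat q) * \<mu> ^ j
     else 0)"

text \<open>
  \<open>delta t \<sigma> y z \<mu>\<close> is \<open>t\<^sup>-\<^sup>1 \<delta>((y - z + \<mu>) / (\<sigma> t)) = \<Sum>n. \<sigma>^(-n) (y - z + \<mu>)^n t^(-n-1)\<close>, for
  \<open>t, y, z\<close> the three distinct even variables and \<open>\<sigma> = \<plusminus>1\<close>.
\<close>

definition delta :: "evar \<Rightarrow> complex \<Rightarrow> evar \<Rightarrow> evar \<Rightarrow> ovar grassmann \<Rightarrow> scalar_series" where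
  "delta t \<sigma> y z \<mu> =
     (\<lambda>e. let n = - e t - 1 in gconst (\<sigma> powi (- n)) * pow_expand \<mu> n (e y) (e z))"

text \<open>
  The product of a scalar series with a vector series. The sum over \<open>e'\<close> is the sum of the finitely
  many nonzero terms; in the Jacobi identity below there are only finitely many of them, by the
  truncation condition.
\<close>

definition series_mult ::
  "(nat grassmann \<Rightarrow> 'v \<Rightarrow> 'v) \<Rightarrow> scalar_series \<Rightarrow> 'v vec_series \<Rightarrow> 'v::ab_group_add vec_series" where
  "series_mult smul d F = (\<lambda>e R. Sum_any (\<lambda>e'. \<Sum>T\<in>Pow R.
     scale smul (msign T (R - T) * gcoeff (d e') T) (F (\<lambda>t. e t - e' t) (R - T))))"

definition odd_mono :: "(pm \<Rightarrow> ovar grassmann) \<Rightarrow> pm set \<Rightarrow> ovar grassmann" where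
  "odd_mono \<theta> S = (if Plus \<in> S then \<theta> Plus else 1) * (if Minus \<in> S then \<theta> Minus else 1)"

text \<open>
  \<open>Y(u,(y,\<theta>\<^sup>+,\<theta>\<^sup>-)) Y(v,(z,\<theta>'\<^sup>+,\<theta>'\<^sup>-)) w\<close> for \<open>u\<close> of parity \<open>i\<close>, with the odd variables moved to
  the left: the sign comes from moving the monomial in \<open>\<theta>'\<close> indexed by \<open>T\<close> past the coefficient of
  \<open>Y u\<close> indexed by \<open>S\<close>, which has parity \<open>i + card S\<close>.
\<close>

definition Y_prod ::
  "(nat grassmann \<Rightarrow> 'v \<Rightarrow> 'v) \<Rightarrow> ('v \<Rightarrow> 'v End_series) \<Rightarrow> evar \<Rightarrow> (pm \<Rightarrow> ovar grassmann) \<Rightarrow>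
   evar \<Rightarrow> (pm \<Rightarrow> ovar grassmann) \<Rightarrow> nat \<Rightarrow> 'v \<Rightarrow> 'v \<Rightarrow> 'v \<Rightarrow> 'v::ab_group_add vec_series" where
  "Y_prod smul Y y \<theta> z \<theta>' i u v w = (\<lambda>e R.
     if \<exists>t. t \<noteq> y \<and> t \<noteq> z \<and> e t \<noteq> 0 then 0
     else \<Sum>S\<in>UNIV. \<Sum>T\<in>UNIV.
       scale smul ((-1) ^ ((i + card S) * card T) * gcoeff (odd_mono \<theta> S * odd_mono \<theta>' T) R)
         (Y u (e y) S (Y v (e z) T w)))"

text \<open>\<open>Y(Y(u,(y,\<theta>\<^sup>+,\<theta>\<^sup>-)) v,(z,\<theta>'\<^sup>+,\<theta>'\<^sup>-)) w\<close>, where \<open>Y\<close> is extended linearly in its argument to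
  series in \<open>y\<close> and the odd variables, the latter being taken out on the left.\<close>

definition Y_iter ::
  "(nat grassmann \<Rightarrow> 'v \<Rightarrow> 'v) \<Rightarrow> ('v \<Rightarrow> 'v End_series) \<Rightarrow> evar \<Rightarrow> (pm \<Rightarrow> ovar grassmann) \<Rightarrow>
   evar \<Rightarrow> (pm \<Rightarrow> ovar grassmann) \<Rightarrow> 'v \<Rightarrow> 'v \<Rightarrow> 'v \<Rightarrow> 'v::ab_group_add vec_series" where
  "Y_iter smul Y y \<theta> z \<theta>' u v w = (\<lambda>e R.
     if \<exists>t. t \<noteq> y \<and> t \<noteq> z \<and> e t \<noteq> 0 then 0
     else \<Sum>S\<in>UNIV. \<Sum>T\<in>UNIV.
       scale smul (gcoeff (odd_mono \<theta> S * odd_mono \<theta>' T) R) (Y (Y u (e y) S v) (e z) T w))"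


section \<open>\<open>N = 2\<close> vertex superalgebras with two odd formal variables\<close>

text \<open>
  \<open>Y_smul\<close> is \<open>Y(a v,(x,\<phi>\<^sup>+,\<phi>\<^sup>-)) = a Y(v,(x,\<phi>\<^sup>+,\<phi>\<^sup>-))\<close>, with the sign from moving \<open>a\<close> past the odd
  variables. The Jacobi identity is an identity of series with coefficients in \<open>End V\<close>, which is
  stated by applying both sides to an arbitrary vector \<open>w\<close>.
\<close>

locale N2_vertex_superalgebra = graded_module L smul Vp
  for L :: enat
    and smul :: "nat grassmann \<Rightarrow> 'v \<Rightarrow> 'v::ab_group_add"
    and Vp :: "nat \<Rightarrow> 'v set" +
  fixes Y :: "'v \<Rightarrow> 'v End_series"
    and vac :: 'v
  assumes Y_add: "Y (u + v) k S w = Y u k S w + Y v k S w"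
    and Y_smul: "i < 2 \<Longrightarrow> a \<in> Lambda_part L i \<Longrightarrow>
      Y (smul a v) k S w = smul ((-1) ^ (i * card S) * a) (Y v k S w)"
    and Y_parity: "j < 2 \<Longrightarrow> v \<in> Vp j \<Longrightarrow>
      Y v k S \<in> End_part L smul Vp ((j + card S) mod 2)"
    and truncation: "\<exists>N. \<forall>n\<ge>N. \<forall>S. mode Y u n S v = 0"
    and vacuum: "Y vac k S = (if k = 0 \<and> S = {} then (\<lambda>w. w) else (\<lambda>w. 0))"
    and creation_regular: "k < 0 \<Longrightarrow> Y v k S vac = 0"
    and creation_value: "Y v 0 {} vac = v"
    and jacobi: "i < 2 \<Longrightarrow> j < 2 \<Longrightarrow> u \<in> Vp i \<Longrightarrow> v \<in> Vp j \<Longrightarrow>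
      series_mult smul (delta X0 1 X1 X2 (- nu)) (Y_prod smul Y X1 phi1 X2 phi2 i u v w) e R
      - scale smul ((-1) ^ (i * j))
          (series_mult smul (delta X0 (-1) X2 X1 nu) (Y_prod smul Y X2 phi2 X1 phi1 j v u w) e R)
      = series_mult smul (delta X2 1 X1 X0 (- nu))
          (Y_iter smul Y X0 (\<lambda>s. phi1 s - phi2 s) X2 phi2 u v w) e R"

text \<open>\<open>D_op Y vac s v\<close> is \<open>v\<^sup>s\<^bsub>-3/2\<^esub> vac\<close>, since \<open>-3/2 = n - 1/2\<close> for \<open>n = -1\<close>.\<close>

definition D_op :: "('v \<Rightarrow> 'v End_series) \<Rightarrow> 'v \<Rightarrow> pm \<Rightarrow> 'v \<Rightarrow> 'v" where
  "D_op Y vac s v = mode Y v (- 1) {s} vac"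

context N2_vertex_superalgebra
begin

lemma vac_even: "vac \<in> Vp 0"
proof -
  obtain v0 v1 where v: "v0 \<in> Vp 0" "v1 \<in> Vp 1" "vac = v0 + v1"
    using Vp_sum by blast
  have even: "Y v0 0 {} w \<in> Vp j" and odd: "Y v1 0 {} w \<in> Vp ((j + 1) mod 2)"
    if "j < 2" "w \<in> Vp j" for w j
    using Y_parity[OF _ v(1), of 0 "{}"] Y_parity[OF _ v(2), of 0 "{}"] that
    by (auto simp: End_part_def image_subset_iff)
  have id: "Y v0 0 {} w + Y v1 0 {} w = w" for w
    using Y_add[of v0 v1 0 "{}" w] vacuum[of 0 "{}"] v(3) by simp
  have neg: "- w \<in> Vp j" if "j < 2" "w \<in> Vp j" for w j
  proof -
    have L: "gconst c \<in> Lambda L" "gconst c \<in> Lambda_part L 0" for c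
      by (auto simp: Lambda_def Lambda_part_def gconst.rep_eq)
    have "gconst (-1) + gconst 1 = (0 :: nat grassmann)" "gconst 1 = (1 :: nat grassmann)"
      by (auto simp: gcoeff_inject[symmetric] plus_grassmann.rep_eq gconst.rep_eq
          zero_grassmann.rep_eq one_grassmann.rep_eq)
    then have "smul (gconst (-1)) w + w = smul 0 w" and "smul 0 w + smul 0 w = smul 0 w"
      using smul_add_left[OF L(1) L(1), of "-1" 1 w] smul_add_left[of 0 0 w] smul_one[of w]
      by (auto simp: Lambda_def zero_grassmann.rep_eq)
    then have "smul (gconst (-1)) w = - w"
      by (simp add: eq_neg_iff_add_eq_0)
    then show ?thesis
      using Vp_smul[OF _ that(1) L(2) that(2), of "-1"] that(1) by simp
  qed
  have zero: "Y v1 0 {} w = 0" if j: "j < 2" and w: "w \<in> Vp j" for w j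
  proof -
    have "Y v1 0 {} w = w + - Y v0 0 {} w"
      using id[of w] by (metis add_diff_cancel_left' diff_conv_add_uminus)
    then have "Y v1 0 {} w \<in> Vp j"
      using Vp_add[OF j w neg[OF j even[OF j w]]] by simp
    moreover have "j = 0 \<or> j = 1" using j by auto
    ultimately have "Y v1 0 {} w \<in> Vp 0 \<inter> Vp 1"
      using odd[OF j w] by (elim disjE) simp_all
    then show ?thesis unfolding Vp_Int by simp
  qed
  have "v1 = Y v1 0 {} (v0 + v1)"
    using creation_value[of v1] v(3) by simp
  also have "\<dots> = Y v1 0 {} v0 + Y v1 0 {} v1"
    using Y_parity[OF _ v(2), of 0 "{}"] by (simp add: End_part_def)
  also have "\<dots> = 0"
    using zero[of 0 v0] zero[of 1 v1] v by simp
  finally show ?thesis using v by simp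
qed

lemma D_op_odd: "D_op Y vac s \<in> End_part L smul Vp 1"
proof -
  have "Y v k {s} vac \<in> Vp ((i + 1) mod 2)" if "i < 2" "v \<in> Vp i" for v i k
  proof -
    have "Y v k {s} vac \<in> Vp ((0 + (i + card {s}) mod 2) mod 2)"
      using Y_parity[OF that, of k "{s}"] vac_even
      unfolding End_part_def image_subset_iff mem_Collect_eq by (meson zero_less_numeral)
    then show ?thesis by simp
  qed
  then show ?thesis
    using Y_smul[where S = "{s}"] by (auto simp: End_part_def D_op_def mode_def Y_add)
qed

end

end

theory Submission
  imports Defs
begin

text \<open>
  In the Jacobi identity for \<open>u\<close> and \<open>\<one>\<close>, the vacuum property makes the left hand side a difference
  of two expansions of \<open>\<delta>\<close> times the same series \<open>Y(u,(x\<^sub>1,\<phi>\<^sub>1\<^sup>+,\<phi>\<^sub>1\<^sup>-))\<close>, and creation leaves only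
  nonnegative powers of \<open>x\<^sub>0\<close> on the right. The coefficient of \<open>x\<^sub>0\<^sup>0 x\<^sub>1\<^sup>-\<^sup>1\<close> is therefore
  \<open>Y(u,(x\<^sub>2 + \<nu>,\<phi>\<^sub>1\<^sup>+,\<phi>\<^sub>1\<^sup>-)) = Y(Y(u,(0,\<phi>\<^sub>1\<^sup>+ - \<phi>\<^sub>2\<^sup>+,\<phi>\<^sub>1\<^sup>- - \<phi>\<^sub>2\<^sup>-))\<one>,(x\<^sub>2,\<phi>\<^sub>2\<^sup>+,\<phi>\<^sub>2\<^sup>-))\<close> with
  \<open>\<nu> = \<phi>\<^sub>1\<^sup>+\<phi>\<^sub>2\<^sup>- + \<phi>\<^sub>1\<^sup>-\<phi>\<^sub>2\<^sup>+\<close>. The theorem is the derivative of this identity in \<open>\<phi>\<^sub>1\<^sup>\<plusminus>\<close> at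
  \<open>\<phi>\<^sub>1 = \<phi>\<^sub>2\<close>.
\<close>

section \<open>Coefficients in the exterior algebra\<close>

lemma gcoeff_mult: "gcoeff (a * b) R = (\<Sum>T\<in>Pow R. msign T (R - T) * gcoeff a T * gcoeff b (R - T))"
  by (simp add: times_grassmann.rep_eq)

lemma gcoeff_gconst_mult: "gcoeff (gconst c * a) R = c * gcoeff a R"
proof (cases "finite R")
  case True
  have "gcoeff (gconst c * a) R = (\<Sum>T\<in>Pow R. if T = {} then c * gcoeff a R else 0)"
    unfolding gcoeff_mult by (rule sum.cong) (auto simp: gconst.rep_eq)
  then show ?thesis using True by (simp add: sum.delta)
next
  case False
  then show ?thesis using gcoeff[of a] gcoeff[of "gconst c * a"] by auto
qed

lemma gcoeff_gen_mult:
  fixes i :: "'i::{linorder,finite}"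
  shows "gcoeff (gen i * a) R = (if i \<in> R then msign {i} (R - {i}) * gcoeff a (R - {i}) else 0)"
proof -
  have "gcoeff (gen i * a) R =
      (\<Sum>T\<in>Pow R. if T = {i} then msign {i} (R - {i}) * gcoeff a (R - {i}) else 0)"
    unfolding gcoeff_mult by (rule sum.cong) (auto simp: gen.rep_eq)
  then show ?thesis by (simp add: sum.delta)
qed

lemma msign_insert_right:
  fixes i :: "'i::{linorder,finite}"
  assumes "j \<notin> B"
  shows "msign {i} (insert j B) = (if j < i then -1 else 1) * msign {i} B"
proof -
  have "msign {i} ({j} \<union> B) = msign {i} {j} * msign {i} B"
    by (rule msign_Un_right) (use assms in auto)
  moreover have "{(a, b). a \<in> {i} \<and> b \<in> {j} \<and> b < a} = (if j < i then {(i, j)} else {})"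
    by auto
  ultimately show ?thesis by (auto simp: msign_def)
qed

lemma gconst_add: "gconst (a + b) = gconst a + gconst b"
  by (simp add: gcoeff_inject[symmetric] plus_grassmann.rep_eq gconst.rep_eq fun_eq_iff)

lemma gconst_mult: "gconst (a * b) = gconst a * gconst b"
  by (simp add: gcoeff_inject[symmetric] gcoeff_gconst_mult gconst.rep_eq fun_eq_iff)

lemma gconst_1: "gconst 1 = 1"
  by (simp add: gcoeff_inject[symmetric] gconst.rep_eq one_grassmann.rep_eq)

lemma gconst_0: "gconst 0 = 0"
  by (simp add: gcoeff_inject[symmetric] gconst.rep_eq zero_grassmann.rep_eq fun_eq_iff)

lemma gconst_minus: "gconst (- c) = - gconst c"
  by (simp add: gcoeff_inject[symmetric] uminus_grassmann.rep_eq gconst.rep_eq fun_eq_iff)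

lemma gconst_minus_1_power: "gconst ((- 1) ^ j) = (- 1) ^ j"
  by (induction j) (simp_all add: gconst_1 gconst_minus)

lemma gconst_in_Lambda: "gconst c \<in> Lambda L"
  by (auto simp: Lambda_def gconst.rep_eq)

lemma UNIV_pm_set: "(UNIV :: pm set set) = {{}, {Plus}, {Minus}, {Plus, Minus}}"
proof -
  have "UNIV = {Plus, Minus}" using pm.exhaust by auto
  then have "(UNIV :: pm set set) = Pow {Plus, Minus}" by (simp flip: Pow_UNIV)
  then show ?thesis by (auto simp: Pow_insert)
qed

sublocale graded_module \<subseteq> scale: module "scale smul"
  by standard
    (simp_all add: scale_def smul_add_right smul_add_left smul_smul smul_one gconst_in_Lambda
      gconst_add gconst_mult gconst_1)

definition expo :: "int \<Rightarrow> int \<Rightarrow> int \<Rightarrow> evar \<Rightarrow> int" where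
  "expo a b c t = (case t of X0 \<Rightarrow> a | X1 \<Rightarrow> b | X2 \<Rightarrow> c)"

lemma expo_simps [simp]: "expo a b c X0 = a" "expo a b c X1 = b" "expo a b c X2 = c"
  by (simp_all add: expo_def)

lemma expo_eq_iff: "e = expo a b c \<longleftrightarrow> e X0 = a \<and> e X1 = b \<and> e X2 = c"
  by (auto simp: fun_eq_iff expo_def split: evar.splits)

lemma ex_evar: "(\<exists>t. P t) \<longleftrightarrow> P X0 \<or> P X1 \<or> P X2"
  by (metis evar.exhaust)

context graded_module
begin

text \<open>The sum over subsets in \<open>series_mult\<close> is multiplication in the exterior
  algebra, so \<open>a\<close> can be absorbed into the odd factors \<open>b S\<close>.\<close>

lemma sum_scale_gcoeff_mult:
  "(\<Sum>T\<in>Pow R. scale smul (msign T (R - T) * gcoeff a T)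
      (\<Sum>S\<in>A. scale smul (gcoeff (b S) (R - T)) (G S))) =
    (\<Sum>S\<in>A. scale smul (gcoeff (a * b S) R) (G S))"
  by (simp add: scale.scale_sum_right gcoeff_mult scale.scale_sum_left)
    (rule sum.swap)

text \<open>Both products in the Jacobi identity for u and \<open>vac\<close> have this form. As x1
  is the only even variable in \<open>F\<close>, \<open>d\<close> must supply x0^0 x2^k, which
  leaves three powers of x1.\<close>

lemma series_mult_x1_series:
  assumes F: "\<And>e R. F e R =
      (if e X0 = 0 \<and> e X2 = 0 then \<Sum>S\<in>A. scale smul (gcoeff (b S) R) (G (e X1) S) else 0)"
    and d: "\<And>p. d (expo 0 p k) = (\<Sum>j\<le>2::nat. if p = - 1 - k - int j then gconst (c j) * a j else 0)"
  shows "series_mult smul d F (expo 0 (-1) k) R =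
    (\<Sum>j\<le>2. scale smul (c j)
      (\<Sum>S\<in>A. scale smul (gcoeff (a j * b S) R) (G (k + int j) S)))"
proof -
  define h where "h = (\<lambda>j::nat. expo 0 (- 1 - k - int j) k)"
  let ?t = "\<lambda>e'. \<Sum>T\<in>Pow R. scale smul (msign T (R - T) * gcoeff (d e') T)
      (F (\<lambda>t. expo 0 (-1) k t - e' t) (R - T))"
  have zero: "?t e' = 0" if "e' \<notin> h ` {..2}" for e'
  proof (cases "e' X0 = 0 \<and> e' X2 = k")
    case True
    then have e': "e' = expo 0 (e' X1) k" by (simp add: expo_eq_iff)
    then have "e' X1 \<noteq> - 1 - k - int j" if "j \<le> 2" for j
      using that \<open>e' \<notin> _\<close> unfolding h_def by fastforce
    then have "d e' = 0" by (subst e', subst d) (auto intro!: sum.neutral)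
    then show ?thesis by (simp add: zero_grassmann.rep_eq)
  next
    case False
    then show ?thesis by (auto simp: F intro!: sum.neutral)
  qed
  have dh: "d (h j) = gconst (c j) * a j" if "j \<le> 2" for j
    unfolding h_def d using that by (simp add: sum.delta)
  have "series_mult smul d F (expo 0 (-1) k) R = (\<Sum>e'\<in>h ` {..2}. ?t e')"
    unfolding series_mult_def
    by (rule Sum_any.expand_superset) (use zero in auto)
  also have "\<dots> = (\<Sum>j\<le>2. ?t (h j))"
    by (subst sum.reindex) (auto simp: inj_on_def h_def expo_eq_iff)
  also have "\<dots> = (\<Sum>j\<le>2. scale smul (c j)
      (\<Sum>S\<in>A. scale smul (gcoeff (a j * b S) R) (G (k + int j) S)))"
  proof (rule sum.cong)
    fix j :: nat assume j: "j \<in> {..2}"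
    have "?t (h j) = (\<Sum>S\<in>A. scale smul (gcoeff (gconst (c j) * a j * b S) R) (G (k + int j) S))"
      using j unfolding sum_scale_gcoeff_mult[symmetric] by (simp add: dh F, simp add: h_def)
    also have "\<dots> = scale smul (c j) (\<Sum>S\<in>A. scale smul (gcoeff (a j * b S) R) (G (k + int j) S))"
      by (simp add: mult.assoc gcoeff_gconst_mult scale.scale_sum_right)
    finally show "?t (h j) = \<dots>" .
  qed simp
  finally show ?thesis .
qed

end

text \<open>The summands are the coefficients of \<open>\<nu>\<^sup>j x\<^sub>1^(-1-k-j) x\<^sub>2\<^sup>k\<close> in \<open>(x\<^sub>1 - x\<^sub>2 - \<nu>)\<^sup>-\<^sup>1\<close> and in
  \<open>(x\<^sub>2 - x\<^sub>1 + \<nu>)\<^sup>-\<^sup>1\<close>, and their sum is the Taylor coefficient of \<open>(x\<^sub>2 + \<nu>)^(k + j)\<close>.\<close>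

lemma gbinomial_combine:
  "(if 0 \<le> k then (- 1 - of_nat j gchoose nat k) * (- 1) ^ nat k else 0)
    + (if 0 \<le> - 1 - k - int j
       then (- 1) ^ j * ((- 1 - of_nat j gchoose nat (- 1 - k - int j)) * (- 1) ^ nat (- 1 - k - int j))
       else 0)
   = (of_int (k + int j) gchoose j :: complex)"
proof -
  have neg: "((- 1 - of_nat j :: complex) gchoose q) * (- 1) ^ q = of_nat ((j + q) choose q)" for q
    using gbinomial_minus[of "1 + of_nat j :: complex" q]
    by (simp add: binomial_gbinomial algebra_simps flip: power_mult_distrib)
  \<comment> \<open>For k >= 0 only the first expansion contributes, for k <= -1 - j only the
    second. In between neither does, and the binomial vanishes since 0 <= k + j < j.\<close>
  consider n where "k = int n" | n where "k = - 1 - int j - int n" | "k < 0" "0 \<le> k + int j"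
  proof -
    assume "\<And>n. k = int n \<Longrightarrow> thesis" "\<And>n. k = - 1 - int j - int n \<Longrightarrow> thesis"
      "k < 0 \<Longrightarrow> 0 \<le> k + int j \<Longrightarrow> thesis"
    from this(1)[of "nat k"] this(2)[of "nat (- 1 - int j - k)"] this(3) show thesis by linarith
  qed
  then show ?thesis
  proof cases
    case 1
    then show ?thesis
      using binomial_symmetric[of j "n + j"]
      by (simp add: neg binomial_gbinomial[symmetric] add.commute flip: of_nat_add)
  next
    case 2
    have "(of_int (k + int j) :: complex) = - (1 + of_nat n)" using 2 by simp
    then have "(of_int (k + int j) gchoose j :: complex) = (- 1) ^ j * (of_nat (n + j) gchoose j)"
      by (simp only: gbinomial_minus) (simp add: add.commute)
    moreover have "nat (- 1 - k - int j) = n" "\<not> 0 \<le> k" "0 \<le> - 1 - k - int j" using 2 by simp_all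
    ultimately show ?thesis
      using binomial_symmetric[of j "n + j"]
      by (simp add: neg binomial_gbinomial[symmetric] add.commute flip: of_nat_add)
  next
    case 3
    then obtain n where "k + int j = int n" "n < j"
      by (metis add_less_same_cancel2 nonneg_int_cases of_nat_less_iff)
    then show ?thesis using 3 by (auto simp flip: binomial_gbinomial)
  qed
qed

section \<open>The Jacobi identity for u and the vacuum\<close>

context N2_vertex_superalgebra
begin

lemma Y_zero_left [simp]: "Y 0 k S w = 0"
  using Y_add[of 0 0 k S w] by simp

lemma Y_zero_right [simp]: "Y v k S 0 = 0"
proof -
  obtain v0 v1 where v: "v0 \<in> Vp 0" "v1 \<in> Vp 1" "v = v0 + v1"
    using Vp_sum by blast
  have "Y x k S (0 + 0) = Y x k S 0 + Y x k S 0" if "x \<in> Vp j" "j < 2" for x j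
    using Y_parity[OF that(2,1), of k S] unfolding End_part_def by blast
  from this[OF v(1)] this[OF v(2)] show ?thesis by (simp add: v(3) Y_add)
qed

lemma Y_prod_vac_right:
  "Y_prod smul Y X1 phi1 X2 phi2 i u vac w e R =
    (if e X0 = 0 \<and> e X2 = 0
     then \<Sum>S\<in>UNIV. scale smul (gcoeff (odd_mono phi1 S) R) (Y u (e X1) S w) else 0)"
proof -
  have "(\<Sum>T\<in>UNIV. scale smul
       ((- 1) ^ ((i + card S) * card T) * gcoeff (odd_mono phi1 S * odd_mono phi2 T) R)
       (Y u k S (Y vac l T w))) =
     (if l = 0 then scale smul (gcoeff (odd_mono phi1 S) R) (Y u k S w) else 0)" for S k l
    by (simp add: UNIV_pm_set vacuum odd_mono_def)
  then show ?thesis by (auto simp: Y_prod_def ex_evar)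
qed

lemma Y_prod_vac_left:
  "Y_prod smul Y X2 phi2 X1 phi1 0 vac u w e R =
    (if e X0 = 0 \<and> e X2 = 0
     then \<Sum>S\<in>UNIV. scale smul (gcoeff (odd_mono phi1 S) R) (Y u (e X1) S w) else 0)"
proof -
  have "(\<Sum>S\<in>UNIV. \<Sum>T\<in>UNIV. scale smul
       ((- 1) ^ ((0 + card S) * card T) * gcoeff (odd_mono phi2 S * odd_mono phi1 T) R)
       (Y vac l S (Y u k T w))) =
     (if l = 0 then \<Sum>S\<in>UNIV. scale smul (gcoeff (odd_mono phi1 S) R) (Y u k S w) else 0)" for k l
    by (simp add: UNIV_pm_set vacuum odd_mono_def)
  then show ?thesis by (auto simp: Y_prod_def ex_evar)
qed

text \<open>Neither factor has negative powers of x0, by the expansion of \<open>delta\<close> and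
  by \<open>creation_regular\<close>. So both contribute x0^0, and x1^-1 comes from
  \<open>delta\<close>.\<close>

lemma series_mult_Y_iter_vac:
  "series_mult smul (delta X2 1 X1 X0 (- nu)) (Y_iter smul Y X0 \<theta> X2 \<theta>' u vac w)
      (expo 0 (- 1) k) R =
    (\<Sum>S\<in>UNIV. \<Sum>T\<in>UNIV.
       scale smul (gcoeff (odd_mono \<theta> S * odd_mono \<theta>' T) R) (Y (Y u 0 S vac) k T w))"
  (is "_ = ?rhs")
proof -
  let ?t = "\<lambda>e'. \<Sum>T\<in>Pow R. scale smul (msign T (R - T) * gcoeff (delta X2 1 X1 X0 (- nu) e') T)
      (Y_iter smul Y X0 \<theta> X2 \<theta>' u vac w (\<lambda>t. expo 0 (- 1) k t - e' t) (R - T))"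
  have delta: "delta X2 1 X1 X0 (- nu) (expo 0 (- 1) l) = (if l = 0 then 1 else 0)" for l
  proof -
    \<comment> \<open>The exponents of x0^0 x1^-1 force n = j - 1, so only j = 0 survives and no
      \<open>nu\<close> remains.\<close>
    have gchoose: "(of_int (int j - 1) gchoose j :: complex) = (if j = 0 then 1 else 0)" for j
      by (cases j) (simp_all flip: binomial_gbinomial)
    have "pow_expand (- nu) (- l - 1) (- 1) 0 = (\<Sum>j\<le>2::nat. if j = 0 then if l = 0 then 1 else 0 else 0)"
      unfolding pow_expand_def
    proof (rule sum.cong)
      fix j :: nat
      have "- l - 1 = int j - 1" if "- 1 + 0 = - l - 1 - int j" using that by simp
      then show "(if 0 \<le> (0::int) \<and> - 1 + 0 = - l - 1 - int j
          then gconst ((of_int (- l - 1) gchoose j) * (of_int (- l - 1 - int j) gchoose nat 0) *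
            (- 1) ^ nat 0) * (- nu) ^ j else 0) =
        (if j = 0 then if l = 0 then 1 else 0 else 0)"
        using gchoose[of j] by (auto simp: gconst_1 gconst_0)
    qed simp
    then show ?thesis by (simp add: delta_def gconst_1 sum.delta)
  qed
  have zero: "?t e' = 0" if "e' \<noteq> expo 0 (- 1) 0" for e'
  proof (cases "e' X1 = - 1 \<and> e' X0 = 0")
    case True
    then have "e' = expo 0 (- 1) (e' X2)" "e' X2 \<noteq> 0" using that by (auto simp: expo_eq_iff)
    then have "delta X2 1 X1 X0 (- nu) e' = 0" using delta by metis
    then show ?thesis by (simp add: zero_grassmann.rep_eq)
  next
    case outside: False
    show ?thesis
    proof (cases "e' X0 < 0")
      case True
      then show ?thesis by (simp add: delta_def pow_expand_def zero_grassmann.rep_eq)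
    next
      case False
      then show ?thesis using outside
        by (auto simp: Y_iter_def ex_evar creation_regular intro!: sum.neutral)
    qed
  qed
  have "series_mult smul (delta X2 1 X1 X0 (- nu)) (Y_iter smul Y X0 \<theta> X2 \<theta>' u vac w)
      (expo 0 (- 1) k) R = (\<Sum>e'\<in>{expo 0 (- 1) 0}. ?t e')"
    unfolding series_mult_def
    by (rule Sum_any.expand_superset) (use zero in auto)
  also have "\<dots> = ?t (expo 0 (- 1) 0)" by simp
  also have "\<dots> = (\<Sum>T\<in>Pow R. if T = {} then ?rhs else 0)"
    by (rule sum.cong) (auto simp: delta one_grassmann.rep_eq Y_iter_def ex_evar)
  also have "\<dots> = ?rhs" by (simp add: sum.delta)
  finally show ?thesis .
qed

text \<open>The coefficient of \<open>x\<^sub>0\<^sup>0 x\<^sub>1\<^sup>-\<^sup>1 x\<^sub>2\<^sup>k\<close> in the Jacobi identity for \<open>u\<close> and \<open>\<one>\<close>; the left hand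
  side is that of \<open>x\<^sub>2\<^sup>k\<close> in \<open>Y(u,(x\<^sub>2 + \<nu>,\<phi>\<^sub>1\<^sup>+,\<phi>\<^sub>1\<^sup>-)) w\<close>.\<close>

lemma Y_translate_homogeneous:
  assumes "i < 2" "u \<in> Vp i"
  shows "(\<Sum>j\<le>2. scale smul (of_int (k + int j) gchoose j)
      (\<Sum>S\<in>UNIV. scale smul (gcoeff (nu ^ j * odd_mono phi1 S) R) (Y u (k + int j) S w))) =
    (\<Sum>S\<in>UNIV. \<Sum>T\<in>UNIV.
       scale smul (gcoeff (odd_mono (\<lambda>s. phi1 s - phi2 s) S * odd_mono phi2 T) R)
         (Y (Y u 0 S vac) k T w))"
proof -
  let ?c1 = "\<lambda>j. if 0 \<le> k then (- 1 - of_nat j gchoose nat k) * (- 1) ^ nat k else 0 :: complex"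
  let ?c2 = "\<lambda>j. if 0 \<le> - 1 - k - int j
    then (- 1) ^ j * ((- 1 - of_nat j gchoose nat (- 1 - k - int j)) * (- 1) ^ nat (- 1 - k - int j))
    else 0 :: complex"
  let ?G = "\<lambda>j. \<Sum>S\<in>UNIV. scale smul (gcoeff (nu ^ j * odd_mono phi1 S) R) (Y u (k + int j) S w)"
  have minus_1: "((- 1 :: complex) gchoose j) = (- 1) ^ j" for j
    using gbinomial_minus[of "1 :: complex" j] by (simp flip: binomial_gbinomial)
  have sign_cancel: "(- 1) ^ j * a * b * (- 1) ^ j = (a * b :: complex)" for a b j
    by (cases "even j") simp_all
  have minus_nu: "gconst c * (- nu) ^ j = gconst (c * (- 1) ^ j) * nu ^ j" for c j
    by (subst power_minus) (simp add: gconst_mult gconst_minus_1_power mult.assoc)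
  have d1: "delta X0 1 X1 X2 (- nu) (expo 0 p k) =
      (\<Sum>j\<le>2. if p = - 1 - k - int j then gconst (?c1 j) * nu ^ j else 0)" for p
    unfolding delta_def pow_expand_def
    by (auto simp: Let_def gconst_1 gconst_0 minus_1 minus_nu sign_cancel intro!: sum.cong)
  \<comment> \<open>The sign before \<open>?c2\<close> is \<sigma>^(-n) for \<sigma> = n = -1. It
    turns the difference in \<open>jacobi\<close> into the sum in
    \<open>gbinomial_combine\<close>.\<close>
  have d2: "delta X0 (- 1) X2 X1 nu (expo 0 p k) =
      (\<Sum>j\<le>2. if p = - 1 - k - int j then gconst (- ?c2 j) * nu ^ j else 0)" for p
    unfolding delta_def pow_expand_def
    by (auto simp: Let_def gconst_1 gconst_0 gconst_minus minus_1 sum_distrib_left mult.assoc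
        intro!: sum.cong)
  have "series_mult smul (delta X0 1 X1 X2 (- nu)) (Y_prod smul Y X1 phi1 X2 phi2 i u vac w)
      (expo 0 (- 1) k) R = (\<Sum>j\<le>2. scale smul (?c1 j) (?G j))"
    by (rule series_mult_x1_series[where a = "\<lambda>j. nu ^ j", OF Y_prod_vac_right d1])
  moreover have "series_mult smul (delta X0 (- 1) X2 X1 nu) (Y_prod smul Y X2 phi2 X1 phi1 0 vac u w)
      (expo 0 (- 1) k) R = (\<Sum>j\<le>2. scale smul (- ?c2 j) (?G j))"
    by (rule series_mult_x1_series[where a = "\<lambda>j. nu ^ j", OF Y_prod_vac_left d2])
  ultimately have "(\<Sum>j\<le>2. scale smul (?c1 j) (?G j)) - (\<Sum>j\<le>2. scale smul (- ?c2 j) (?G j)) =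
      (\<Sum>S\<in>UNIV. \<Sum>T\<in>UNIV.
         scale smul (gcoeff (odd_mono (\<lambda>s. phi1 s - phi2 s) S * odd_mono phi2 T) R)
           (Y (Y u 0 S vac) k T w))"
    using jacobi[OF assms(1) _ assms(2) vac_even, of w "expo 0 (- 1) k" R]
    by (simp add: series_mult_Y_iter_vac)
  moreover have "(\<Sum>j\<le>2. scale smul (?c1 j) (?G j)) - (\<Sum>j\<le>2. scale smul (- ?c2 j) (?G j)) =
      (\<Sum>j\<le>2. scale smul (?c1 j + ?c2 j) (?G j))"
    unfolding sum_subtractf[symmetric] scale.scale_minus_left scale.scale_left_distrib by simp
  ultimately show ?thesis unfolding gbinomial_combine by simp
qed

lemma Y_translate:
  "(\<Sum>j\<le>2. scale smul (of_int (k + int j) gchoose j)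
      (\<Sum>S\<in>UNIV. scale smul (gcoeff (nu ^ j * odd_mono phi1 S) R) (Y u (k + int j) S w))) =
    (\<Sum>S\<in>UNIV. \<Sum>T\<in>UNIV.
       scale smul (gcoeff (odd_mono (\<lambda>s. phi1 s - phi2 s) S * odd_mono phi2 T) R)
         (Y (Y u 0 S vac) k T w))"
proof -
  obtain u0 u1 where u: "u0 \<in> Vp 0" "u1 \<in> Vp 1" "u = u0 + u1"
    using Vp_sum by blast
  show ?thesis
    using Y_translate_homogeneous[OF _ u(1), of k R w] Y_translate_homogeneous[OF _ u(2), of k R w]
    by (simp add: u(3) Y_add scale.scale_right_distrib sum.distrib)
qed

text \<open>For simplification: expands explicit odd polynomials and reads off coefficients by
  stripping leading generators with their signs.\<close>

lemmas odd_eval = UNIV_pm_set odd_mono_def nu_def phi1_def phi2_def numeral_2_eq_2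
  distrib_left distrib_right left_diff_distrib right_diff_distrib mult.assoc
  gcoeff_gen_mult msign_insert_right plus_grassmann.rep_eq minus_grassmann.rep_eq
  uminus_grassmann.rep_eq zero_grassmann.rep_eq one_grassmann.rep_eq gen.rep_eq
  insert_Diff_if insert_commute[of Minus Plus] less_ovar_def less_pm_def

text \<open>Instead of setting \<phi>1 = \<phi>2, coefficients are compared: since
  \<open>D_op Y vac s u\<close> is \<open>Y u 0 {s} vac\<close>, the left side here occurs in
  \<open>Y_translate\<close> at \<phi>1^s times the \<phi>2-monomial of \<open>S\<close>.\<close>

lemma Y_D_op:
  "Y (D_op Y vac s u) k S w =
    diff_phi smul s (Y u) k S w + mult_phi smul (opp s) (diff_x smul (Y u)) k S w"
proof -
  have neg: "scale smul (- c - 1) v = - scale smul (c + 1) v" for c v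
    by (simp flip: scale.scale_minus_left)
  have "S \<in> {{}, {Plus}, {Minus}, {Plus, Minus}}" using UNIV_pm_set by auto
  \<comment> \<open>The second coefficient serves to cancel the contribution of \<open>Y(u\<^sup>+\<^sup>-\<^bsub>-2\<^esub>\<one>,(x,\<phi>\<^sup>+,\<phi>\<^sup>-))\<close>, which comes
    from the product of \<open>\<phi>\<^sub>1\<^sup>+ - \<phi>\<^sub>2\<^sup>+\<close> and \<open>\<phi>\<^sub>1\<^sup>- - \<phi>\<^sub>2\<^sup>-\<close>, when \<open>S\<close> contains \<open>opp s\<close>.\<close>
  then show ?thesis
    using Y_translate[of k "insert (Phi1 s) (Phi2 ` S)" u w]
      Y_translate[of k "{Phi1 Plus, Phi1 Minus} \<union> Phi2 ` (S - {opp s})" u w]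
    by (cases s; elim insertE emptyE)
      (simp_all add: odd_eval D_op_def mode_def diff_phi_def mult_phi_def diff_x_def neg
        eq_neg_iff_add_eq_0, metis add.commute eq_neg_iff_add_eq_0 minus_minus)
qed

end

theorem proposition2p2:
  fixes L :: enat
    and smul :: "nat grassmann \<Rightarrow> 'v \<Rightarrow> 'v::ab_group_add"
    and Vp :: "nat \<Rightarrow> 'v set"
    and Y :: "'v \<Rightarrow> 'v End_series"
    and vac v :: 'v
    and s :: pm
  assumes "N2_vertex_superalgebra L smul Vp Y vac"
  shows "Y (D_op Y vac s v) =
    (\<lambda>k S w. diff_phi smul s (Y v) k S w + mult_phi smul (opp s) (diff_x smul (Y v)) k S w)"
  using N2_vertex_superalgebra.Y_D_op[OF assms] by (intro ext)

end
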